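(* Let $n\ge 11$. (1) If $T$ is a starlike tree of order $n$ with maximum degree $\Delta(T)=3$, $T\notin S_n$, and $T\ne P_n(4,4,n-9)$, then $T\prec P_n(4,4,n-9)$. (2) If $T$ is a starlike tree of order $n$ with $\Delta(T)\ge 4$ and $T\ne P_n(2,2,2,n-7)$, then $T\prec P_n(2,2,2,n-7)$.
   Context: A tree is starlike if it has at most one vertex of degree at least $3$. $P_n(a_1,\dots,a_k)$ ($k\ge3$, $a_i\ge1$, $\sum a_i=n-1$) is the tree of order $n$ consisting of a central vertex with $k$ internally disjoint pendent paths of lengths $a_1,\dots,a_k$. $S_n=\{P_n(2,a,b)\mid a+b=n-3,\ 1\le a\le b\}$. For trees $T_1,T_2$ of the same order, $T_1\prec T_2$ means $m(T_1,i)\le m(T_2,i)$ for all $i$ with strict inequality for some $i$, where $m(T,i)$ is the number of $i$-matchings of $T$. *)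

theory Defs
  imports Main
begin

section \<open>Finite simple graphs and trees\<close>

record 'a graph =
  verts :: "'a set"
  edges :: "'a set set"

definition simple_graph :: "'a graph \<Rightarrow> bool" where
  "simple_graph G \<longleftrightarrow> finite (verts G) \<and> (\<forall>e \<in> edges G. e \<subseteq> verts G \<and> card e = 2)"

abbreviation order :: "'a graph \<Rightarrow> nat" where
  "order G \<equiv> card (verts G)"

definition degree :: "'a graph \<Rightarrow> 'a \<Rightarrow> nat" where
  "degree G v = card {e \<in> edges G. v \<in> e}"

definition max_degree :: "'a graph \<Rightarrow> nat" where
  "max_degree G = Max (degree G ` verts G)"

definition connected_graph :: "'a graph \<Rightarrow> bool" where
  "connected_graph G \<longleftrightarrow> verts G \<noteq> {} \<and>
     (\<forall>u \<in> verts G. \<forall>v \<in> verts G. (u, v) \<in> {(x, y). {x, y} \<in> edges G}\<^sup>*)"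

definition cycle :: "'a graph \<Rightarrow> 'a list \<Rightarrow> bool" where
  "cycle G c \<longleftrightarrow> length c \<ge> 3 \<and> distinct c \<and>
     (\<forall>i < length c. {c ! i, c ! (Suc i mod length c)} \<in> edges G)"

definition tree :: "'a graph \<Rightarrow> bool" where
  "tree G \<longleftrightarrow> simple_graph G \<and> connected_graph G \<and> (\<nexists>c. cycle G c)"

definition starlike :: "'a graph \<Rightarrow> bool" where
  "starlike G \<longleftrightarrow> tree G \<and> card {v \<in> verts G. degree G v \<ge> 3} \<le> 1"

definition graph_iso :: "'a graph \<Rightarrow> 'b graph \<Rightarrow> bool" where
  "graph_iso G H \<longleftrightarrow> (\<exists>f. bij_betw f (verts G) (verts H) \<and>
     (\<forall>u \<in> verts G. \<forall>v \<in> verts G. {u, v} \<in> edges G \<longleftrightarrow> {f u, f v} \<in> edges H))"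


section \<open>Matchings\<close>

definition matching :: "'a graph \<Rightarrow> 'a set set \<Rightarrow> bool" where
  "matching G M \<longleftrightarrow> M \<subseteq> edges G \<and> pairwise disjnt M"

definition num_matchings :: "'a graph \<Rightarrow> nat \<Rightarrow> nat" where
  "num_matchings G i = card {M. matching G M \<and> card M = i}"

text \<open>The relation is only meant for trees of the same order.\<close>

definition matching_less :: "'a graph \<Rightarrow> 'b graph \<Rightarrow> bool" (infix \<open>\<prec>\<close> 50) where
  "G \<prec> H \<longleftrightarrow> (\<forall>i. num_matchings G i \<le> num_matchings H i) \<and>
     (\<exists>i. num_matchings G i < num_matchings H i)"


section \<open>The trees \<open>P\<^sub>n(a\<^sub>1, \<dots>, a\<^sub>k)\<close>\<close>

text \<open>
  \<open>leg_vertex i j\<close> is the vertex at distance \<open>j\<close> from the centre on the \<open>i\<close>-th leg; at distance 0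
  it is the centre \<open>(0, 0)\<close> for every leg.
\<close>

definition leg_vertex :: "nat \<Rightarrow> nat \<Rightarrow> nat \<times> nat" where
  "leg_vertex i j = (if j = 0 then (0, 0) else (i, j))"

text \<open>
  A fixed copy of \<open>P\<^sub>n(a\<^sub>1, \<dots>, a\<^sub>k)\<close> for \<open>as = [a\<^sub>1, \<dots>, a\<^sub>k]\<close>. The index \<open>n\<close> is determined by the
  list, namely \<open>n = 1 + a\<^sub>1 + \<dots> + a\<^sub>k\<close> (see \<open>order_P_tree\<close>). Only lists with \<open>k \<ge> 3\<close> and all \<open>a\<^sub>i \<ge> 1\<close>
  are meaningful.
\<close>

definition P_tree :: "nat list \<Rightarrow> (nat \<times> nat) graph" where
  "P_tree as = \<lparr> verts = insert (0, 0) {leg_vertex i j | i j. i < length as \<and> j \<le> as ! i},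
            edges = {{leg_vertex i j, leg_vertex i (Suc j)} | i j. i < length as \<and> j < as ! i} \<rparr>"

definition S_trees :: "nat \<Rightarrow> (nat \<times> nat) graph set" where
  "S_trees n = {P_tree [2, a, b] | a b. a + b = n - 3 \<and> 1 \<le> a \<and> a \<le> b}"

lemma verts_P_tree:
  "verts (P_tree as) = insert (0, 0) (SIGMA i:{..<length as}. {1..as ! i})"
proof (intro equalityI subsetI)
  fix v assume "v \<in> verts (P_tree as)"
  then show "v \<in> insert (0, 0) (SIGMA i:{..<length as}. {1..as ! i})"
    by (auto simp: P_tree_def leg_vertex_def split: if_splits)
next
  fix v assume "v \<in> insert (0, 0) (SIGMA i:{..<length as}. {1..as ! i})"
  then have "v = (0, 0) \<or>
      v = leg_vertex (fst v) (snd v) \<and> fst v < length as \<and> snd v \<le> as ! fst v"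
    by (auto simp: leg_vertex_def)
  then show "v \<in> verts (P_tree as)"
    unfolding P_tree_def by auto
qed

lemma order_P_tree: "order (P_tree as) = Suc (sum_list as)"
proof -
  have "card (SIGMA i:{..<length as}. {1..as ! i}) = sum_list as"
    by (simp add: sum_list_sum_nth atLeast0LessThan)
  then show ?thesis
    unfolding verts_P_tree by (subst card_insert_disjoint) auto
qed

lemma tree_P_tree: "tree (P_tree as)"
proof -
  have fin: "finite (verts (P_tree as))"
    unfolding verts_P_tree by simp
  have "card e = 2" "e \<subseteq> verts (P_tree as)" if "e \<in> edges (P_tree as)" for e
  proof -
    from that obtain i j where ij: "i < length as" "j < as ! i"
      and e: "e = {leg_vertex i j, leg_vertex i (Suc j)}"
      by (auto simp: P_tree_def)
    show "card e = 2"
      unfolding e by (auto simp: leg_vertex_def)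
    show "e \<subseteq> verts (P_tree as)"
      using ij unfolding e verts_P_tree by (auto simp: leg_vertex_def)
  qed
  with fin have "simple_graph (P_tree as)"
    by (simp add: simple_graph_def)
  moreover have "connected_graph (P_tree as)"
  proof -
    let ?R = "{(x, y). {x, y} \<in> edges (P_tree as)}"
    have *: "((0, 0), leg_vertex i j) \<in> ?R\<^sup>*" if "i < length as" "j \<le> as ! i" for i j
      using that
    proof (induction j)
      case 0
      then show ?case by (simp add: leg_vertex_def)
    next
      case (Suc j)
      then have "(leg_vertex i j, leg_vertex i (Suc j)) \<in> ?R"
        unfolding P_tree_def by fastforce
      with Suc show ?case
        by (meson Suc_leD rtrancl.rtrancl_into_rtrancl)
    qed
    have c: "((0, 0), v) \<in> ?R\<^sup>*" if "v \<in> verts (P_tree as)" for v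
      using that * by (auto simp: P_tree_def)
    have "sym (?R\<^sup>*)"
      by (rule sym_rtrancl) (auto simp: sym_def insert_commute)
    with c have "(u, v) \<in> ?R\<^sup>*" if "u \<in> verts (P_tree as)" "v \<in> verts (P_tree as)" for u v
      using that by (meson rtrancl_trans symE)
    moreover have "verts (P_tree as) \<noteq> {}"
      by (simp add: P_tree_def)
    ultimately show ?thesis
      by (simp add: connected_graph_def)
  qed
  moreover have False if "cycle (P_tree as) c" for c
  proof -
    let ?n = "length c"
    have n: "?n \<ge> 3" and d: "distinct c"
      and e: "\<And>i. i < ?n \<Longrightarrow> {c ! i, c ! (Suc i mod ?n)} \<in> edges (P_tree as)"
      using that by (auto simp: cycle_def)
    \<comment> \<open>a vertex of the cycle farthest from the centre has only one neighbour not farther away\<close>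
    have parent: "v = leg_vertex (fst u) (snd u - 1)"
      if "{u, v} \<in> edges (P_tree as)" "snd v \<le> snd u" for u v
      using that by (auto simp: P_tree_def leg_vertex_def doubleton_eq_iff split: if_splits)
    have "finite (snd ` set c)" "snd ` set c \<noteq> {}"
      using n by auto
    then have "Max (snd ` set c) \<in> snd ` set c" "\<And>v. v \<in> set c \<Longrightarrow> snd v \<le> Max (snd ` set c)"
      by simp_all
    then obtain u where u: "u \<in> set c" "\<And>v. v \<in> set c \<Longrightarrow> snd v \<le> snd u"
      by (metis imageE)
    then obtain i where i: "i < ?n" "u = c ! i"
      by (metis in_set_conv_nth)
    define p where "p = (if i = 0 then ?n - 1 else i - 1)"
    define q where "q = (if Suc i = ?n then 0 else Suc i)"
    have pq: "p < ?n" "q < ?n" "p \<noteq> q" "Suc p mod ?n = i" "Suc i mod ?n = q"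
      using n i by (auto simp: p_def q_def split: if_splits)
    have "{c ! i, c ! p} \<in> edges (P_tree as)" "{c ! i, c ! q} \<in> edges (P_tree as)"
      using e[OF pq(1)] e[OF i(1)] pq by (auto simp: insert_commute)
    then have "c ! p = c ! q"
      using parent u i pq(1,2) by (metis nth_mem)
    with d pq show False
      by (simp add: nth_eq_iff_index_eq)
  qed
  ultimately show ?thesis
    by (auto simp: tree_def)
qed

end

theory Submission
  imports Defs "HOL-Computational_Algebra.Polynomial" "HOL-Combinatorics.List_Permutation"
begin

text \<open>
  Fix all legs of a starlike tree except two, of lengths \<open>a\<close> and \<open>b\<close>. With \<open>a + b\<close> fixed, the matching
  polynomial is a constant plus the product of the path polynomials of \<open>a\<close> and \<open>b\<close> vertices times a
  polynomial with nonnegative coefficients, so two trees that differ in two legs are compared through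
  such products. Replacing \<open>(b, c)\<close> by \<open>(4, b + c - 4)\<close> twice turns any admissible triple of legs into
  \<open>(4, 4, n - 9)\<close>. For at least four legs, merging two of them into one of length \<open>a + b\<close> reduces to
  exactly four, and three replacements of \<open>(x, d)\<close> by \<open>(2, x + d - 2)\<close> lead to \<open>(2, 2, 2, n - 7)\<close>. No
  step decreases a coefficient, and a step that changes the legs increases one.
\<close>

hide_const (open) Polynomial.order Polynomial.degree
hide_fact (open) Polynomial.degree_def

section \<open>Polynomials with nonnegative coefficients\<close>

definition X :: "int poly" where "X = [:0, 1:]"

lemma coeff_X_power: "coeff (X ^ k) i = (if i = k then 1 else 0)"
  unfolding X_def by (simp flip: monom_altdef[of 1, simplified])

lemma X_neq_0 [simp]: "X \<noteq> 0"
  by (simp add: X_def)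

text \<open>The coefficientwise order of polynomials is written \<open>nonneg (q - p)\<close>. This
  is the weak half of \<open>\<prec>\<close>, and \<open>q - p \<noteq> 0\<close> supplies the
  strict half.\<close>

definition nonneg :: "int poly \<Rightarrow> bool" where
  "nonneg p \<longleftrightarrow> (\<forall>i. coeff p i \<ge> 0)"

lemma nonneg_0 [simp]: "nonneg 0" and nonneg_1 [simp]: "nonneg 1"
  and nonneg_X [simp]: "nonneg X"
  by (auto simp: nonneg_def X_def coeff_pCons split: nat.split)

lemma nonneg_add [simp]: "nonneg p \<Longrightarrow> nonneg q \<Longrightarrow> nonneg (p + q)"
  by (simp add: nonneg_def)

lemma nonneg_mult [simp]: "nonneg p \<Longrightarrow> nonneg q \<Longrightarrow> nonneg (p * q)"
  by (simp add: nonneg_def coeff_mult sum_nonneg)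

lemma nonneg_power [simp]: "nonneg p \<Longrightarrow> nonneg (p ^ k)"
  by (induction k) simp_all

text \<open>Nothing cancels in a sum of nonnegative polynomials. So if the total of a chain of
  comparisons vanishes, every single step vanishes; this is how strictness and the equality cases
  are tracked.\<close>

lemma nonneg_add_eq_0_iff:
  assumes "nonneg p" "nonneg q"
  shows "p + q = 0 \<longleftrightarrow> p = 0 \<and> q = 0"
  using assms by (auto simp: nonneg_def poly_eq_iff add_nonneg_eq_0_iff)

section \<open>The matching polynomial\<close>

text \<open>The generating polynomial of the matchings, without the alternating signs of the
  classical matching polynomial. It takes an edge set instead of a graph, because deleting vertices
  then amounts to filtering edges.\<close>

definition matching_poly :: "'a set set \<Rightarrow> int poly" where
  "matching_poly E = (\<Sum>M | M \<subseteq> E \<and> pairwise disjnt M. X ^ card M)"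

lemma coeff_matching_poly:
  assumes "finite (edges G)"
  shows "coeff (matching_poly (edges G)) i = int (num_matchings G i)"
proof -
  have "coeff (matching_poly (edges G)) i =
      (\<Sum>M | M \<subseteq> edges G \<and> pairwise disjnt M. if card M = i then 1 else 0)"
    unfolding matching_poly_def coeff_sum coeff_X_power by (intro sum.cong) auto
  also have "\<dots> = int (card {M. matching G M \<and> card M = i})"
    using assms by (subst sum.If_cases) (auto simp: matching_def intro!: arg_cong[where f = card])
  finally show ?thesis
    by (simp add: num_matchings_def)
qed

lemma matching_less_iff:
  assumes "finite (edges G)" "finite (edges H)"
  shows "G \<prec> H \<longleftrightarrow> nonneg (matching_poly (edges H) - matching_poly (edges G)) \<and>
    matching_poly (edges H) - matching_poly (edges G) \<noteq> 0"
proof -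
  have "G \<prec> H \<longleftrightarrow> (\<forall>i. num_matchings G i \<le> num_matchings H i) \<and>
      (\<exists>i. num_matchings H i \<noteq> num_matchings G i)"
    unfolding matching_less_def by (metis nat_less_le)
  then show ?thesis
    using assms by (simp add: nonneg_def poly_eq_iff coeff_matching_poly)
qed

lemma matching_poly_empty [simp]: "matching_poly {} = 1"
proof -
  have "{M. M \<subseteq> {} \<and> pairwise disjnt M} = {{} :: 'a set set}"
    by auto
  then show ?thesis
    by (simp add: matching_poly_def)
qed

text \<open>A matching either avoids \<open>e\<close>, or consists of \<open>e\<close> and a
  matching among the edges disjoint from \<open>e\<close>; the factor \<open>X\<close> accounts for
  \<open>e\<close> itself.\<close>

lemma matching_poly_insert:
  assumes "finite E" "e \<notin> E"
  shows "matching_poly (insert e E) = matching_poly E + X * matching_poly {f \<in> E. disjnt f e}"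
proof -
  let ?A = "{M. M \<subseteq> E \<and> pairwise disjnt M}"
  let ?B = "{M. M \<subseteq> {f \<in> E. disjnt f e} \<and> pairwise disjnt M}"
  have split: "{M. M \<subseteq> insert e E \<and> pairwise disjnt M} = ?A \<union> insert e ` ?B"
  proof (intro equalityI subsetI)
    fix M assume M: "M \<in> {M. M \<subseteq> insert e E \<and> pairwise disjnt M}"
    show "M \<in> ?A \<union> insert e ` ?B"
    proof (cases "e \<in> M")
      case True
      then have "M - {e} \<in> ?B" "M = insert e (M - {e})"
        using M True by (auto simp: pairwise_def)
      then show ?thesis
        by (intro UnI2 image_eqI[of M _ "M - {e}"])
    qed (use M in auto)
  next
    fix M assume "M \<in> ?A \<union> insert e ` ?B"
    then show "M \<in> {M. M \<subseteq> insert e E \<and> pairwise disjnt M}"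
    proof
      assume "M \<in> insert e ` ?B"
      then obtain N where N: "M = insert e N" "N \<subseteq> {f \<in> E. disjnt f e}" "pairwise disjnt N"
        by blast
      have "disjnt f e \<and> disjnt e f" if "f \<in> N" for f
        using that N(2) disjnt_sym by blast
      then have "pairwise disjnt M"
        using N(3) unfolding N(1) pairwise_insert by simp
      moreover have "M \<subseteq> insert e E"
        using N(1,2) by auto
      ultimately show ?thesis
        by simp
    qed blast
  qed
  have e: "e \<notin> M" if "M \<in> ?B" for M
    using that assms(2) by blast
  have "inj_on (insert e) ?B"
    by (rule inj_onI) (use e insert_ident in metis)
  moreover have "card (insert e M) = Suc (card M)" if "M \<in> ?B" for M
  proof -
    from that have "finite M"
      using finite_subset[OF _ assms(1)] by auto
    then show ?thesis
      using e[OF that] by (rule card_insert_disjoint)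
  qed
  ultimately have "(\<Sum>M \<in> insert e ` ?B. X ^ card M) = X * (\<Sum>M \<in> ?B. X ^ card M)"
    by (simp add: sum.reindex sum_distrib_left)
  moreover have "?A \<inter> insert e ` ?B = {}"
    using assms(2) by auto
  moreover have "finite ?A" "finite ?B"
    using assms(1) by simp_all
  ultimately show ?thesis
    unfolding matching_poly_def split by (simp add: sum.union_disjoint)
qed

text \<open>An edge \<open>e\<close> of \<open>F\<close> is split off. The recurrence leads both to
  \<open>F'\<close> and to its edges disjoint from \<open>e\<close>, so the induction is over all
  proper subsets. The condition \<open>E \<inter> F = {}\<close> rules out a common empty edge,
  which would be disjoint from itself.\<close>

lemma matching_poly_Un:
  assumes "finite E" "finite F" "\<And>e f. e \<in> E \<Longrightarrow> f \<in> F \<Longrightarrow> disjnt e f" "E \<inter> F = {}"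
  shows "matching_poly (E \<union> F) = matching_poly E * matching_poly F"
  using assms(2-4)
proof (induction F rule: finite_psubset_induct)
  case (psubset F)
  show ?case
  proof (cases "F = {}")
    case False
    then obtain e where "e \<in> F"
      by blast
    define F' where "F' = F - {e}"
    have F: "F = insert e F'" "e \<notin> F'" "finite F'" "e \<notin> E"
      using \<open>e \<in> F\<close> psubset by (auto simp: F'_def)
    have IH: "matching_poly (E \<union> F') = matching_poly E * matching_poly F'"
      "matching_poly (E \<union> {f \<in> F'. disjnt f e}) = matching_poly E * matching_poly {f \<in> F'. disjnt f e}"
      by (rule psubset.IH; use psubset.prems F in auto)+
    have filter: "{f \<in> E \<union> F'. disjnt f e} = E \<union> {f \<in> F'. disjnt f e}"
      using psubset.prems F by auto
    have "matching_poly (E \<union> F) = matching_poly (insert e (E \<union> F'))"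
      by (simp add: F)
    also have "\<dots> = matching_poly (E \<union> F') + X * matching_poly (E \<union> {f \<in> F'. disjnt f e})"
      unfolding filter[symmetric] using assms(1) F by (subst matching_poly_insert) auto
    also have "\<dots> = matching_poly E * matching_poly (insert e F')"
      unfolding IH using F by (subst matching_poly_insert) (auto simp: algebra_simps)
    finally show ?thesis
      by (simp add: F)
  qed simp
qed

lemma matching_poly_image:
  assumes "inj_on f (\<Union>E)"
  shows "matching_poly ((`) f ` E) = matching_poly E"
proof -
  have inj: "inj_on ((`) f) E"
    using inj_on_image[OF assms] .
  have disjnt: "disjnt (f ` a) (f ` b) \<longleftrightarrow> disjnt a b" if "a \<in> E" "b \<in> E" for a b
  proof -
    have "f ` a \<inter> f ` b = f ` (a \<inter> b)"
      using inj_on_image_Int[OF assms, of a b] that by blast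
    then show ?thesis
      by (simp add: disjnt_def)
  qed
  let ?A = "{M. M \<subseteq> E \<and> pairwise disjnt M}"
  have "{M. M \<subseteq> (`) f ` E \<and> pairwise disjnt M} = (`) ((`) f) ` ?A" (is "?L = ?R")
  proof (intro equalityI subsetI)
    fix M assume M: "M \<in> ?L"
    then obtain N where "N \<subseteq> E" "M = (`) f ` N"
      by (auto simp: subset_image_iff)
    have "disjnt a b" if "a \<in> N" "b \<in> N" "a \<noteq> b" for a b
    proof -
      have "f ` a \<noteq> f ` b" "a \<in> E" "b \<in> E"
        using that inj \<open>N \<subseteq> E\<close> unfolding inj_on_def by blast+
      then show ?thesis
        using that M disjnt[of a b] unfolding \<open>M = _\<close> by (simp add: pairwise_def)
    qed
    then have "N \<in> ?A"
      using \<open>N \<subseteq> E\<close> by (simp add: pairwise_def)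
    then show "M \<in> ?R"
      unfolding \<open>M = _\<close> by blast
  next
    fix M assume "M \<in> ?R"
    then obtain N where "N \<subseteq> E" "pairwise disjnt N" "M = (`) f ` N"
      by blast
    moreover from this have "disjnt (f ` a) (f ` b)" if "a \<in> N" "b \<in> N" "f ` a \<noteq> f ` b" for a b
    proof -
      have "a \<noteq> b"
        using that(3) by blast
      then have "disjnt a b"
        using that \<open>pairwise disjnt N\<close> by (simp add: pairwise_def)
      then show ?thesis
        using disjnt that \<open>N \<subseteq> E\<close> by blast
    qed
    ultimately show "M \<in> ?L"
      by (auto simp: pairwise_def)
  qed
  moreover have "inj_on ((`) ((`) f)) ?A"
    by (rule inj_onI) (use inj_on_image_eq_iff[OF inj] in blast)
  moreover have "card ((`) f ` M) = card M" if "M \<in> ?A" for M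
    using that inj by (intro card_image) (auto intro: inj_on_subset)
  ultimately show ?thesis
    unfolding matching_poly_def by (simp add: sum.reindex)
qed

lemma finite_edges: "simple_graph G \<Longrightarrow> finite (edges G)"
  unfolding simple_graph_def by (rule finite_subset[of _ "Pow (verts G)"]) auto

lemma matching_poly_iso:
  assumes "graph_iso G H" "simple_graph G" "simple_graph H"
  shows "matching_poly (edges G) = matching_poly (edges H)"
proof -
  obtain f where f: "bij_betw f (verts G) (verts H)"
    and e: "\<And>u v. u \<in> verts G \<Longrightarrow> v \<in> verts G \<Longrightarrow> {u, v} \<in> edges G \<longleftrightarrow> {f u, f v} \<in> edges H"
    using assms(1) by (auto simp: graph_iso_def)
  have 1: "f ` d \<in> edges H" if "d \<in> edges G" for d
  proof -
    have "d \<subseteq> verts G" "card d = 2"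
      using that assms(2) by (auto simp: simple_graph_def)
    then obtain u v where "d = {u, v}" "u \<in> verts G" "v \<in> verts G"
      unfolding card_2_iff by blast
    with that e show ?thesis by auto
  qed
  have 2: "d \<in> (`) f ` edges G" if "d \<in> edges H" for d
  proof -
    have "d \<subseteq> f ` verts G" "card d = 2"
      using that assms(3) f by (auto simp: simple_graph_def bij_betw_def)
    moreover obtain u v where "d = {u, v}"
      using \<open>card d = 2\<close> by (auto simp: card_2_iff)
    ultimately obtain u' v' where "d = f ` {u', v'}" "u' \<in> verts G" "v' \<in> verts G"
      by auto
    moreover from this that e have "{u', v'} \<in> edges G"
      by simp
    ultimately show ?thesis
      by blast
  qed
  have "edges H = (`) f ` edges G"
    using 1 2 by blast
  moreover have "inj_on f (\<Union>(edges G))"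
    by (rule inj_on_subset[of _ "verts G"]) (use f assms(2) in \<open>auto simp: bij_betw_def simple_graph_def\<close>)
  ultimately show ?thesis
    by (simp add: matching_poly_image)
qed

section \<open>Matching polynomials of paths\<close>

text \<open>The index counts vertices: \<open>path_poly n\<close> is the matching polynomial of the
  path on \<open>n\<close> vertices, a Fibonacci-type polynomial. The recurrence distinguishes
  whether the last edge is in the matching, and the value at 0 stands for the empty path.\<close>

fun path_poly :: "nat \<Rightarrow> int poly" where
  "path_poly 0 = 1"
| "path_poly (Suc 0) = 1"
| "path_poly (Suc (Suc n)) = path_poly (Suc n) + X * path_poly n"

lemma nonneg_path_poly [simp]: "nonneg (path_poly n)"
  by (induction n rule: path_poly.induct) simp_all

lemma coeff_0_path_poly: "coeff (path_poly n) 0 = 1"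
  by (induction n rule: path_poly.induct) (simp_all add: X_def)

lemma path_poly_neq_0 [simp]: "path_poly n \<noteq> 0"
  using coeff_0_path_poly[of n] by auto

text \<open>The analogue of d'Ocagne's identity for Fibonacci numbers. Expanding the first factor of
  the first product and the longest path of the second makes a common product cancel, so raising
  \<open>k\<close> by one multiplies the difference by \<open>- X\<close>.\<close>

lemma path_poly_docagne:
  "path_poly (Suc k) * path_poly (Suc k + s) - path_poly k * path_poly (Suc (Suc (k + s))) =
    (- X) ^ Suc k * path_poly s"
proof (induction k)
  case 0
  then show ?case by simp
next
  case (Suc k)
  have "path_poly (Suc (Suc k)) * path_poly (Suc (Suc k) + s) - path_poly (Suc k) * path_poly (Suc (Suc (Suc k + s)))
    = - X * (path_poly (Suc k) * path_poly (Suc k + s) - path_poly k * path_poly (Suc (Suc (k + s))))"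
    by (simp add: algebra_simps)
  then show ?case
    unfolding Suc by (simp)
qed

text \<open>Two ways to split the same number of vertices into two paths are compared. For fixed
  \<open>k\<close> and \<open>s\<close> both sides satisfy the path recurrence in \<open>r\<close>,
  and \<open>path_poly_docagne\<close> supplies the starting values \<open>r = 0\<close> and
  \<open>r = 1\<close>.\<close>

lemma path_poly_exchange:
  "path_poly (Suc (k + r)) * path_poly (Suc (k + s)) - path_poly k * path_poly (Suc (Suc (k + r + s))) =
    (- X) ^ Suc k * path_poly r * path_poly s"
proof (induction r rule: path_poly.induct)
  case 1
  then show ?case using path_poly_docagne[of k s] by (simp)
next
  case 2
  then show ?case using path_poly_docagne[of k s] by (simp add: algebra_simps)
next
  case (3 n)
  have "path_poly (Suc (k + Suc (Suc n))) * path_poly (Suc (k + s)) - path_poly k * path_poly (Suc (Suc (k + Suc (Suc n) + s)))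
    = (path_poly (Suc (k + Suc n)) * path_poly (Suc (k + s)) - path_poly k * path_poly (Suc (Suc (k + Suc n + s))))
     + X * (path_poly (Suc (k + n)) * path_poly (Suc (k + s)) - path_poly k * path_poly (Suc (Suc (k + n + s))))"
    by (simp add: algebra_simps)
  also have "\<dots> = (- X) ^ Suc k * path_poly (Suc (Suc n)) * path_poly s"
    unfolding 3 by (simp add: algebra_simps)
  finally show ?case .
qed

section \<open>Matching polynomials of starlike trees\<close>

text \<open>The lower bound \<open>k\<close> describes what deletions leave of a leg: 0 for the
  whole leg, 1 once the centre is gone, 2 once its first vertex is gone too.\<close>

definition leg_edges :: "nat \<Rightarrow> nat \<Rightarrow> nat \<Rightarrow> (nat \<times> nat) set set" where
  "leg_edges i k l = {{leg_vertex i j, leg_vertex i (Suc j)} | j. k \<le> j \<and> j < l}"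

lemma leg_vertex_eq_iff [simp]: "leg_vertex i j = leg_vertex i' j' \<longleftrightarrow> j = j' \<and> (j = 0 \<or> i = i')"
  by (auto simp: leg_vertex_def)

lemma leg_edges_empty [simp]: "leg_edges i k k = {}"
  by (auto simp: leg_edges_def)

lemma leg_edge_in_leg_edges_iff:
  "{leg_vertex i j, leg_vertex i (Suc j)} \<in> leg_edges i' k l \<longleftrightarrow> i = i' \<and> k \<le> j \<and> j < l"
  by (auto simp: leg_edges_def doubleton_eq_iff)

lemma leg_edges_disjnt_centre:
  "{f \<in> leg_edges i' k l. disjnt f {leg_vertex i 0, leg_vertex i 1}} =
    leg_edges i' (if i = i' then max 2 k else max 1 k) l"
  by (auto simp: leg_edges_def)

lemma leg_edges_Suc:
  assumes "k \<le> l"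
  shows "leg_edges i k (Suc l) = insert {leg_vertex i l, leg_vertex i (Suc l)} (leg_edges i k l)"
  using assms unfolding leg_edges_def by (auto simp: less_Suc_eq)

lemma leg_edges_first:
  assumes "k < l"
  shows "leg_edges i k l = insert {leg_vertex i k, leg_vertex i (Suc k)} (leg_edges i (Suc k) l)"
  using assms unfolding leg_edges_def by (auto simp: Suc_le_eq le_less)

lemma finite_leg_edges [simp]: "finite (leg_edges i k l)"
proof -
  have "leg_edges i k l = (\<lambda>j. {leg_vertex i j, leg_vertex i (Suc j)}) ` {k..<l}"
    by (auto simp: leg_edges_def)
  then show ?thesis by simp
qed

text \<open>A stretch of \<open>d\<close> edges is a path on \<open>d + 1\<close> vertices, whence
  the \<open>Suc\<close>. Removing the last edge gives exactly the recurrence of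
  \<open>path_poly\<close>.\<close>

lemma matching_poly_leg_edges: "matching_poly (leg_edges i k (k + d)) = path_poly (Suc d)"
proof (induction d rule: path_poly.induct)
  case 1
  then show ?case by simp
next
  case 2
  have "leg_edges i k (Suc k) = insert {leg_vertex i k, leg_vertex i (Suc k)} {}"
    by (auto simp: leg_edges_def)
  then show ?case
    by (simp add: matching_poly_insert)
next
  case (3 n)
  let ?e = "{leg_vertex i (Suc (k + n)), leg_vertex i (Suc (Suc (k + n)))}"
  have "?e \<notin> leg_edges i k (Suc (k + n))"
    by (auto simp: leg_edges_def doubleton_eq_iff)
  moreover have "{f \<in> leg_edges i k (Suc (k + n)). disjnt f ?e} = leg_edges i k (k + n)"
    by (auto simp: leg_edges_def disjnt_def less_Suc_eq)
  ultimately show ?case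
    using 3 by (simp add: leg_edges_Suc[of k "Suc (k + n)"] matching_poly_insert)
qed

text \<open>What is left when the centre is deleted: disjoint paths, the \<open>i\<close>-th on
  \<open>as ! i\<close> vertices.\<close>

definition outer_edges :: "nat list \<Rightarrow> (nat \<times> nat) set set" where
  "outer_edges as = (\<Union>i<length as. leg_edges i 1 (as ! i))"

lemma edges_P_tree: "edges (P_tree as) = (\<Union>i<length as. leg_edges i 0 (as ! i))"
  by (auto simp: P_tree_def leg_edges_def)

lemma edges_P_tree_snoc:
  "edges (P_tree (as @ [a])) = edges (P_tree as) \<union> leg_edges (length as) 0 a"
  unfolding edges_P_tree by (simp add: lessThan_Suc nth_append Un_commute)

lemma outer_edges_snoc: "outer_edges (as @ [a]) = outer_edges as \<union> leg_edges (length as) 1 a"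
  unfolding outer_edges_def by (simp add: lessThan_Suc nth_append Un_commute)

lemma disjnt_leg_edges:
  assumes "i \<noteq> i'" "e \<in> leg_edges i k l" "f \<in> leg_edges i' (Suc k') l'"
  shows "disjnt e f"
  using assms by (auto simp: leg_edges_def)

lemma leg_edges_neq_empty: "e \<in> leg_edges i k l \<Longrightarrow> e \<noteq> {}"
  by (auto simp: leg_edges_def)

text \<open>Different legs can meet only in the centre. The lower bound \<open>Suc k\<close> keeps
  the new leg away from it, so the product formula applies.\<close>

lemma matching_poly_Un_leg_edges:
  assumes "finite E" "\<And>e. e \<in> E \<Longrightarrow> \<exists>j<i. \<exists>k l. e \<in> leg_edges j k l"
  shows "matching_poly (E \<union> leg_edges i (Suc k) l) = matching_poly E * matching_poly (leg_edges i (Suc k) l)"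
proof (rule matching_poly_Un)
  show dj: "disjnt e f" if "e \<in> E" "f \<in> leg_edges i (Suc k) l" for e f
    using assms(2)[OF that(1)] that(2) disjnt_leg_edges by (metis nat_neq_iff)
  show "E \<inter> leg_edges i (Suc k) l = {}"
  proof (rule equals0I)
    fix e assume e: "e \<in> E \<inter> leg_edges i (Suc k) l"
    then have "disjnt e e"
      using dj by blast
    with e leg_edges_neq_empty show False
      by (auto simp: disjnt_def)
  qed
qed (use assms in auto)

lemma matching_poly_outer_edges:
  assumes "\<forall>a\<in>set as. 1 \<le> a"
  shows "matching_poly (outer_edges as) = prod_list (map path_poly as)"
  using assms
proof (induction as rule: rev_induct)
  case Nil
  then show ?case by (simp add: outer_edges_def)
next
  case (snoc a as)
  have "matching_poly (outer_edges (as @ [a])) = matching_poly (outer_edges as) * matching_poly (leg_edges (length as) 1 a)"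
    unfolding outer_edges_snoc One_nat_def by (rule matching_poly_Un_leg_edges) (auto simp: outer_edges_def)
  also have "matching_poly (leg_edges (length as) 1 a) = path_poly a"
    using matching_poly_leg_edges[of "length as" 1 "a - 1"] snoc.prems by simp
  finally show ?case
    using snoc by simp
qed

text \<open>
  \<open>leg_sum as\<close> enumerates the matchings of \<open>P_tree as\<close> covering the centre, and \<open>star_poly as\<close> all
  of them.
\<close>

primrec leg_sum :: "nat list \<Rightarrow> int poly" where
  "leg_sum [] = 0"
| "leg_sum (a # as) = path_poly a * leg_sum as + X * path_poly (a - 1) * prod_list (map path_poly as)"

definition star_poly :: "nat list \<Rightarrow> int poly" where
  "star_poly as = prod_list (map path_poly as) + leg_sum as"

lemma leg_sum_snoc:
  "leg_sum (as @ [a]) = path_poly a * leg_sum as + X * path_poly (a - 1) * prod_list (map path_poly as)"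
  by (induction as) (simp_all add: algebra_simps)

text \<open>Legs are attached one at a time, and the recurrence is applied to the edge
  \<open>e\<close> joining the centre to the new leg. Without \<open>e\<close> the smaller tree and
  a path on \<open>a\<close> vertices remain; with \<open>e\<close> there remain the outer paths of
  the old legs and a path on \<open>a - 1\<close> vertices.\<close>

lemma matching_poly_P_tree:
  assumes "\<forall>a\<in>set as. 1 \<le> a"
  shows "matching_poly (edges (P_tree as)) = star_poly as"
  using assms
proof (induction as rule: rev_induct)
  case Nil
  then show ?case by (simp add: edges_P_tree star_poly_def)
next
  case (snoc a as)
  let ?i = "length as" and ?E = "edges (P_tree as)"
  define e where "e = {leg_vertex ?i 0, leg_vertex ?i 1}"
  have a: "1 \<le> a"
    using snoc.prems by simp
  have E: "\<exists>j<?i. \<exists>k l. f \<in> leg_edges j k l" if "f \<in> ?E" for f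
    using that unfolding edges_P_tree by auto
  have outer: "\<exists>j<?i. \<exists>k l. f \<in> leg_edges j k l" if "f \<in> outer_edges as" for f
    using that unfolding outer_edges_def by auto
  have fin: "finite ?E" "finite (outer_edges as)"
    unfolding edges_P_tree outer_edges_def by auto
  have "edges (P_tree (as @ [a])) = insert e (?E \<union> leg_edges ?i 1 a)"
    unfolding edges_P_tree_snoc using leg_edges_first[of 0 a ?i] a by (simp add: e_def)
  moreover have "e \<notin> ?E \<union> leg_edges ?i 1 a"
    unfolding edges_P_tree e_def One_nat_def by (simp add: leg_edge_in_leg_edges_iff)
  moreover have "{f \<in> ?E \<union> leg_edges ?i 1 a. disjnt f e} = outer_edges as \<union> leg_edges ?i (Suc 1) a"
  proof -
    have "{f \<in> ?E \<union> leg_edges ?i 1 a. disjnt f e} =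
        (\<Union>j<?i. {f \<in> leg_edges j 0 (as ! j). disjnt f e}) \<union> {f \<in> leg_edges ?i 1 a. disjnt f e}"
      unfolding edges_P_tree by blast
    then show ?thesis
      unfolding e_def leg_edges_disjnt_centre outer_edges_def
      by (simp add: numeral_2_eq_2)
  qed
  ultimately have "matching_poly (edges (P_tree (as @ [a]))) =
      matching_poly (?E \<union> leg_edges ?i (Suc 0) a) + X * matching_poly (outer_edges as \<union> leg_edges ?i (Suc 1) a)"
    using fin by (simp add: matching_poly_insert)
  also have "\<dots> = star_poly as * matching_poly (leg_edges ?i (Suc 0) a) +
      X * (prod_list (map path_poly as) * matching_poly (leg_edges ?i (Suc 1) a))"
    using snoc fin E outer by (simp add: matching_poly_Un_leg_edges matching_poly_outer_edges)
  also have "matching_poly (leg_edges ?i (Suc 0) a) = path_poly a"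
    using matching_poly_leg_edges[of ?i 1 "a - 1"] a by simp
  \<comment> \<open>For \<open>a = 1\<close> no vertex of the leg is left, which matches
    \<open>path_poly 0 = 1\<close>. The formula for stretches of a leg yields only paths with at
    least one vertex, so this case is separate.\<close>
  also have "matching_poly (leg_edges ?i (Suc 1) a) = path_poly (a - 1)"
  proof (cases "a = 1")
    case True
    then show ?thesis by (simp add: leg_edges_def)
  next
    case False
    with a show ?thesis
      using matching_poly_leg_edges[of ?i 2 "a - 2"] by (simp add: numeral_2_eq_2 Suc_diff_Suc)
  qed
  finally show ?case
    by (simp add: star_poly_def leg_sum_snoc algebra_simps)
qed

section \<open>Starlike trees as joined paths\<close>

text \<open>The map is exposed because the induction that rebuilds a tree must know which vertex
  goes to the centre.\<close>

definition is_iso :: "('a \<Rightarrow> 'b) \<Rightarrow> 'a graph \<Rightarrow> 'b graph \<Rightarrow> bool" where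
  "is_iso f G H \<longleftrightarrow> bij_betw f (verts G) (verts H) \<and>
     (\<forall>u \<in> verts G. \<forall>v \<in> verts G. {u, v} \<in> edges G \<longleftrightarrow> {f u, f v} \<in> edges H)"

lemma graph_iso_iff_is_iso: "graph_iso G H \<longleftrightarrow> (\<exists>f. is_iso f G H)"
  by (simp add: graph_iso_def is_iso_def)

lemma is_iso_comp:
  assumes "is_iso f G H" "is_iso g H K"
  shows "is_iso (g \<circ> f) G K"
proof -
  have "f u \<in> verts H" if "u \<in> verts G" for u
    using assms(1) that by (auto simp: is_iso_def bij_betw_def)
  then show ?thesis
    using assms by (auto simp: is_iso_def intro: bij_betw_trans)
qed

text \<open>Serves to put a removed leaf back: \<open>w\<close> hangs at \<open>u\<close> on one
  side and \<open>q\<close> hangs at \<open>f u\<close> on the other.\<close>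

lemma is_iso_extend:
  assumes iso: "is_iso f G' H'" and simple: "simple_graph G'" "simple_graph H'"
    and new: "w \<notin> verts G'" "q \<notin> verts H'" and u: "u \<in> verts G'"
    and G: "verts G = insert w (verts G')" "edges G = insert {u, w} (edges G')"
    and H: "verts H = insert q (verts H')" "edges H = insert {f u, q} (edges H')"
  shows "is_iso (f(w := q)) G H"
proof -
  let ?f = "f(w := q)"
  have f: "bij_betw f (verts G') (verts H')"
    and e: "\<And>x y. x \<in> verts G' \<Longrightarrow> y \<in> verts G' \<Longrightarrow> {x, y} \<in> edges G' \<longleftrightarrow> {f x, f y} \<in> edges H'"
    using iso by (auto simp: is_iso_def)
  have inj: "x = y" if "f x = f y" "x \<in> verts G'" "y \<in> verts G'" for x y
    using f that by (auto simp: bij_betw_def dest: inj_onD)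
  have im: "f x \<in> verts H'" if "x \<in> verts G'" for x
    using f that by (auto simp: bij_betw_def)
  have "bij_betw ?f (verts G') (verts H')"
    using new by (intro bij_betw_cong[THEN iffD1, OF _ f]) auto
  then have "bij_betw ?f (verts G) (verts H)"
    using notIn_Un_bij_betw[of w "verts G'" ?f "verts H'"] new by (simp add: G H)
  moreover have no: "x \<noteq> w \<and> y \<noteq> w" if "{x, y} \<in> edges G'" for x y
    using that simple new by (auto simp: simple_graph_def)
  moreover have no': "x \<noteq> q \<and> y \<noteq> q" if "{x, y} \<in> edges H'" for x y
    using that simple new by (auto simp: simple_graph_def)
  have "{x, y} \<in> edges G \<longleftrightarrow> {?f x, ?f y} \<in> edges H" if xy: "x \<in> verts G" "y \<in> verts G" for x y
  proof -
    consider "x = w" "y = w" | "x = w" "y \<in> verts G'" | "x \<in> verts G'" "y = w"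
      | "x \<in> verts G'" "y \<in> verts G'"
      using xy unfolding G by blast
    then show ?thesis
    proof cases
      case 1
      have "u \<noteq> w" "f u \<noteq> q"
        using u im new by auto
      with 1 show ?thesis
        using no[of w w] no'[of q q] by (auto simp: G H doubleton_eq_iff)
    next
      case 2
      then have "y \<noteq> w" "f y \<noteq> q" "u \<noteq> w" "f u \<noteq> q"
        using u im new by auto
      with 2 show ?thesis
        using no[of w y] no'[of q "f y"] inj u by (auto simp: G H doubleton_eq_iff)
    next
      case 3
      then have "x \<noteq> w" "f x \<noteq> q" "u \<noteq> w" "f u \<noteq> q"
        using u im new by auto
      with 3 show ?thesis
        using no[of x w] no'[of "f x" q] inj u by (auto simp: G H doubleton_eq_iff)
    next
      case 4
      then have "x \<noteq> w" "y \<noteq> w" "f x \<noteq> q" "f y \<noteq> q"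
        using im new by auto
      with 4 e show ?thesis
        by (auto simp: G H doubleton_eq_iff)
    qed
  qed
  ultimately show ?thesis
    by (simp add: is_iso_def)
qed

section \<open>Leaves of trees and their removal\<close>

lemma edgeE:
  assumes "simple_graph G" "e \<in> edges G" "w \<in> e"
  obtains y where "e = {y, w}" "y \<noteq> w" "y \<in> verts G"
proof -
  have "card e = 2" "e \<subseteq> verts G"
    using assms by (auto simp: simple_graph_def)
  then obtain a b where "e = {a, b}" "a \<noteq> b"
    by (auto simp: card_2_iff)
  then show thesis
    using that[of a] that[of b] assms(3) \<open>e \<subseteq> verts G\<close> by (cases "w = b") auto
qed

text \<open>The last vertex of a longest path starting at \<open>v\<close> is a leaf.\<close>

lemma tree_leafE:
  assumes "tree G" "v \<in> verts G" "verts G \<noteq> {v}"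
  obtains u w where "u \<in> verts G" "w \<in> verts G" "w \<noteq> v" "u \<noteq> w" "{e \<in> edges G. w \<in> e} = {{u, w}}"
proof -
  let ?E = "edges G"
  have simple: "simple_graph G" and conn: "connected_graph G" and acyclic: "\<nexists>c. cycle G c"
    using assms(1) by (auto simp: tree_def)
  define path where "path xs \<longleftrightarrow> xs \<noteq> [] \<and> hd xs = v \<and> distinct xs \<and> set xs \<subseteq> verts G \<and>
      (\<forall>i. Suc i < length xs \<longrightarrow> {xs ! i, xs ! Suc i} \<in> ?E)" for xs
  have "length xs < Suc (card (verts G))" if "path xs" for xs
    using that simple card_mono[of "verts G" "set xs"]
    by (auto simp: path_def simple_graph_def distinct_card)
  moreover have "path [v]"
    using assms(2) by (simp add: path_def)
  ultimately obtain xs where xs: "path xs" and maximal: "\<And>ys. path ys \<Longrightarrow> length ys \<le> length xs"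
    using ex_has_greatest_nat_lemma[of path "[v]" length] ex_has_greatest_nat[of path "[v]" length "Suc (card (verts G))"]
    by (metis less_imp_le)
  obtain z where "z \<in> verts G" "z \<noteq> v"
    using assms by blast
  then have "(v, z) \<in> {(x, y). {x, y} \<in> ?E}\<^sup>*"
    using conn assms(2) by (auto simp: connected_graph_def)
  with \<open>z \<noteq> v\<close> obtain y where "{v, y} \<in> ?E"
    by (auto elim: converse_rtranclE)
  moreover from this obtain y' where "{v, y} = {y', v}" "y' \<noteq> v" "y' \<in> verts G"
    using edgeE[OF simple] by blast
  ultimately have "path [v, y]"
    using assms(2) by (auto simp: path_def doubleton_eq_iff less_Suc_eq insert_commute)
  define m where "m = length xs"
  have m: "m \<ge> 2"
    using maximal[OF \<open>path [v, y]\<close>] by (simp add: m_def)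
  define w where "w = xs ! (m - 1)"
  define u where "u = xs ! (m - 2)"
  have dist: "distinct xs" and sub: "set xs \<subseteq> verts G" and "xs ! 0 = v"
    and adj: "\<And>i. Suc i < m \<Longrightarrow> {xs ! i, xs ! Suc i} \<in> ?E"
    using xs by (auto simp: path_def m_def hd_conv_nth)
  have "w \<noteq> v"
    using nth_eq_iff_index_eq[OF dist, of "m - 1" 0] m \<open>xs ! 0 = v\<close> by (simp add: w_def flip: m_def)
  have "u \<noteq> w"
    using nth_eq_iff_index_eq[OF dist, of "m - 2" "m - 1"] m by (simp add: w_def u_def flip: m_def)
  have "u \<in> set xs" "w \<in> set xs"
    using m by (auto simp: u_def w_def m_def)
  with sub have "u \<in> verts G" "w \<in> verts G"
    by auto
  have uw: "{u, w} \<in> ?E"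
    using adj[of "m - 2"] m by (simp add: u_def w_def Suc_diff_Suc numeral_2_eq_2)
  have "e = {u, w}" if "e \<in> ?E" "w \<in> e" for e
  proof -
    obtain y where y: "e = {y, w}" "y \<noteq> w" "y \<in> verts G"
      using edgeE[OF simple \<open>e \<in> ?E\<close> \<open>w \<in> e\<close>] .
    \<comment> \<open>Otherwise appending \<open>y\<close> would give a longer path.\<close>
    have "y \<in> set xs"
    proof (rule ccontr)
      assume "y \<notin> set xs"
      have "{(xs @ [y]) ! i, (xs @ [y]) ! Suc i} \<in> ?E" if "Suc i < length (xs @ [y])" for i
      proof (cases "Suc i < m")
        case True
        then show ?thesis
          using adj[of i] by (simp add: nth_append m_def)
      next
        case False
        then have "length xs = Suc i" "m - 1 = i"
          using that by (simp_all add: m_def)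
        then show ?thesis
          using y \<open>e \<in> ?E\<close> by (simp add: nth_append w_def insert_commute)
      qed
      then have "path (xs @ [y])"
        using xs y \<open>y \<notin> set xs\<close> unfolding path_def by simp
      from maximal[OF this] show False
        by simp
    qed
    then obtain k where k: "k < m" "y = xs ! k"
      by (auto simp: in_set_conv_nth m_def)
    have "k \<noteq> m - 1"
      using k y by (auto simp: w_def)
    have "k = m - 2"
    proof (rule ccontr)
      assume "k \<noteq> m - 2"
      with k \<open>k \<noteq> m - 1\<close> have k2: "k + 2 < m"
        by linarith
      \<comment> \<open>The end of the path from \<open>y\<close> to \<open>w\<close> is closed to a
        cycle by the edge \<open>e\<close>; \<open>k + 2 < m\<close> guarantees three
        vertices.\<close>
      let ?c = "drop k xs"
      have len: "length ?c = m - k"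
        by (simp add: m_def)
      have "{?c ! i, ?c ! (Suc i mod length ?c)} \<in> ?E" if "i < length ?c" for i
      proof (cases "Suc i = m - k")
        case True
        then have "k + i = m - 1"
          using k2 by linarith
        then show ?thesis
          using True k2 y k \<open>e \<in> ?E\<close> unfolding len by (simp add: w_def m_def insert_commute)
      next
        case False
        then have "Suc (k + i) < m"
          using that unfolding len by linarith
        with adj[OF this] False that show ?thesis
          unfolding len by (simp add: m_def)
      qed
      then have "cycle G ?c"
        using k2 dist unfolding cycle_def by (auto simp: m_def)
      with acyclic show False by blast
    qed
    then show ?thesis
      using k y by (simp add: u_def)
  qed
  then have "{e \<in> ?E. w \<in> e} = {{u, w}}"
    using uw by blast
  then show thesis
    using that \<open>u \<in> verts G\<close> \<open>w \<in> verts G\<close> \<open>w \<noteq> v\<close> \<open>u \<noteq> w\<close> by blast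
qed

lemma tree_remove_leaf:
  assumes "tree G" "u \<in> verts G" "w \<in> verts G" "u \<noteq> w" and leaf: "{e \<in> edges G. w \<in> e} = {{u, w}}"
  shows "tree \<lparr>verts = verts G - {w}, edges = {e \<in> edges G. w \<notin> e}\<rparr>" (is "tree ?G'")
proof -
  have simple: "simple_graph G" and conn: "connected_graph G" and acyclic: "\<nexists>c. cycle G c"
    using assms(1) by (auto simp: tree_def)
  let ?R = "{(x, y). {x, y} \<in> edges G}" and ?R' = "{(x, y). {x, y} \<in> edges ?G'}"
  \<comment> \<open>A walk is rerouted around \<open>w\<close> by staying at \<open>u\<close> during
    a visit to \<open>w\<close>. This is possible because \<open>{u, w}\<close> is the only edge at
    \<open>w\<close>.\<close>
  have walk: "(x, if y = w then u else y) \<in> ?R'\<^sup>*" if "x \<noteq> w" "(x, y) \<in> ?R\<^sup>*" for x y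
    using that(2)
  proof (induction rule: rtrancl_induct)
    case base
    then show ?case using \<open>x \<noteq> w\<close> by simp
  next
    case (step y z)
    then have yz: "{y, z} \<in> edges G"
      by simp
    have nb: "{y, z} = {u, w}" if "w \<in> {y, z}"
    proof -
      have "{y, z} \<in> {e \<in> edges G. w \<in> e}"
        using yz that by simp
      then show ?thesis
        by (simp add: leaf)
    qed
    show ?case
    proof (cases "w \<in> {y, z}")
      case True
      with nb[OF True] have "(if y = w then u else y) = (if z = w then u else z)"
        by (auto simp: doubleton_eq_iff)
      with step.IH show ?thesis
        by simp
    next
      case False
      then have "y \<noteq> w" "z \<noteq> w" "(y, z) \<in> ?R'"
        using yz by auto
      moreover from this have "(x, y) \<in> ?R'\<^sup>*"
        using step.IH by simp
      ultimately have "(x, z) \<in> ?R'\<^sup>*"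
        by (meson rtrancl.rtrancl_into_rtrancl)
      then show ?thesis
        using \<open>z \<noteq> w\<close> by simp
    qed
  qed
  have "connected_graph ?G'"
    unfolding connected_graph_def
  proof (intro conjI ballI)
    show "verts ?G' \<noteq> {}"
      using assms(2,4) by auto
    fix x y assume "x \<in> verts ?G'" "y \<in> verts ?G'"
    then have xy: "x \<in> verts G" "x \<noteq> w" "y \<in> verts G" "y \<noteq> w"
      by simp_all
    then have "(x, y) \<in> ?R\<^sup>*"
      using conn unfolding connected_graph_def by blast
    from walk[OF xy(2) this] xy(4) show "(x, y) \<in> ?R'\<^sup>*"
      by simp
  qed
  moreover have "simple_graph ?G'"
    using simple by (auto simp: simple_graph_def)
  moreover have "cycle G c" if "cycle ?G' c" for c
    using that by (auto simp: cycle_def)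
  ultimately show ?thesis
    using acyclic by (auto simp: tree_def)
qed

section \<open>Classification of trees with at most one branching vertex\<close>

lemma simple_P_tree: "simple_graph (P_tree as)"
  using tree_P_tree[of as] unfolding tree_def by (rule conjunct1)

text \<open>Induction on the order: a leaf \<open>w\<close> other than \<open>v\<close> is removed
  and put back. If its neighbour \<open>u\<close> is \<open>v\<close>, a new leg of length 1 arises;
  otherwise \<open>u\<close> is the end of a leg, which grows by one.\<close>

lemma tree_iso_P_tree:
  assumes "tree G" "v \<in> verts G" "\<And>u. u \<in> verts G \<Longrightarrow> u \<noteq> v \<Longrightarrow> degree G u \<le> 2"
  shows "\<exists>as f. (\<forall>a\<in>set as. 1 \<le> a) \<and> length as = degree G v \<and> f v = (0, 0) \<and> is_iso f G (P_tree as)"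
  using assms
proof (induction "card (verts G)" arbitrary: G rule: less_induct)
  case less
  have simple: "simple_graph G"
    using less.prems(1) by (simp add: tree_def)
  have fin: "finite (verts G)" "finite (edges G)"
    using simple finite_edges by (auto simp: simple_graph_def)
  show ?case
  proof (cases "verts G = {v}")
    case True
    have no: "e \<notin> edges G" for e
    proof
      assume "e \<in> edges G"
      then have "e \<subseteq> {v}" "card e = 2"
        using simple True by (auto simp: simple_graph_def)
      then show False
        using card_mono[of "{v}" e] by simp
    qed
    then have "edges G = {}"
      by blast
    then have "is_iso (\<lambda>_. (0, 0)) G (P_tree [])"
      by (simp add: is_iso_def True verts_P_tree edges_P_tree bij_betw_def)
    then show ?thesis
      using no by (intro exI[of _ "[]"] exI[of _ "\<lambda>_. (0, 0)"]) (simp add: degree_def)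
  next
    case False
    then obtain u w where uw: "u \<in> verts G" "w \<in> verts G" "w \<noteq> v" "u \<noteq> w"
      and leaf: "{e \<in> edges G. w \<in> e} = {{u, w}}"
      using tree_leafE[OF less.prems(1,2)] by blast
    define G' where "G' = \<lparr>verts = verts G - {w}, edges = {e \<in> edges G. w \<notin> e}\<rparr>"
    have G: "verts G = insert w (verts G')" "edges G = insert {u, w} (edges G')"
      and new: "w \<notin> verts G'" "u \<in> verts G'" "\<And>e. e \<in> edges G' \<Longrightarrow> w \<notin> e"
      using uw leaf by (auto simp: G'_def)
    have tree': "tree G'"
      unfolding G'_def using tree_remove_leaf[OF less.prems(1) uw(1,2,4) leaf] .
    then have simple': "simple_graph G'"
      by (simp add: tree_def)
    have "card (verts G') < card (verts G)"
      using fin new(1) by (simp add: G)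
    moreover have "v \<in> verts G'"
      using less.prems(2) uw by (simp add: G)
    moreover have "degree G' x \<le> 2" if "x \<in> verts G'" "x \<noteq> v" for x
    proof -
      have "degree G' x \<le> degree G x"
        unfolding degree_def using fin by (intro card_mono) (auto simp: G)
      also have "\<dots> \<le> 2"
        using less.prems(3) that by (simp add: G)
      finally show ?thesis .
    qed
    ultimately obtain as f where as: "\<forall>a\<in>set as. 1 \<le> a" "length as = degree G' v"
      and f: "f v = (0, 0)" "is_iso f G' (P_tree as)"
      using less.hyps[of G'] tree' by metis
    have bij: "bij_betw f (verts G') (verts (P_tree as))"
      and e: "\<And>x y. x \<in> verts G' \<Longrightarrow> y \<in> verts G' \<Longrightarrow> {x, y} \<in> edges G' \<longleftrightarrow> {f x, f y} \<in> edges (P_tree as)"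
      using f(2) by (auto simp: is_iso_def)
    note extend = is_iso_extend[OF f(2) simple' simple_P_tree new(1) _ new(2) G]
    show ?thesis
    proof (cases "u = v")
      case True
      have "is_iso (f(w := (length as, 1))) G (P_tree (as @ [1]))"
      proof (rule extend)
        show "verts (P_tree (as @ [1])) = insert (length as, 1) (verts (P_tree as))"
          by (auto simp: verts_P_tree nth_append less_Suc_eq split: if_splits)
        show "edges (P_tree (as @ [1])) = insert {f u, (length as, 1)} (edges (P_tree as))"
          unfolding edges_P_tree_snoc using leg_edges_first[of 0 1 "length as"]
          by (simp add: True f leg_vertex_def)
      qed (simp add: verts_P_tree)
      moreover have "degree G v = Suc (degree G' v)"
      proof -
        have "{e \<in> edges G. v \<in> e} = insert {u, w} {e \<in> edges G'. v \<in> e}"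
          by (auto simp: G True)
        moreover have "{u, w} \<notin> {e \<in> edges G'. v \<in> e}"
          using new(3)[of "{u, w}"] by blast
        ultimately show ?thesis
          using finite_edges[OF simple'] by (simp add: degree_def)
      qed
      ultimately show ?thesis
        using as f uw by (intro exI[of _ "as @ [1]"] exI[of _ "f(w := (length as, 1))"]) auto
    next
      case False
      have "f u \<in> verts (P_tree as)" "f u \<noteq> (0, 0)"
        using bij new(2) \<open>v \<in> verts G'\<close> False f(1) inj_on_eq_iff[of f "verts G'" u v]
        by (auto simp: bij_betw_def)
      then obtain i j where ij: "f u = (i, j)" "i < length as" "1 \<le> j" "j \<le> as ! i"
        by (auto simp: verts_P_tree)
      then have fu: "f u = leg_vertex i j"
        by (simp add: leg_vertex_def)
      \<comment> \<open>Were \<open>u\<close> an inner vertex of its leg, its two neighbours there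
        together with \<open>w\<close> would give it degree at least 3.\<close>
      have j: "j = as ! i"
      proof (rule ccontr)
        assume "j \<noteq> as ! i"
        with ij have less: "j < as ! i"
          by simp
        have E: "{leg_vertex i k, leg_vertex i (Suc k)} \<in> edges (P_tree as)" if "k < as ! i" for k
          using that ij(2) by (auto simp: edges_P_tree leg_edge_in_leg_edges_iff)
        then have "{f u, leg_vertex i (Suc j)} \<in> edges (P_tree as)" "{f u, leg_vertex i (j - 1)} \<in> edges (P_tree as)"
          using less ij(3) E[of "j - 1"] unfolding fu by (auto simp: insert_commute)
        moreover from this have "leg_vertex i (Suc j) \<in> f ` verts G'" "leg_vertex i (j - 1) \<in> f ` verts G'"
          using bij simple_P_tree[of as] by (auto simp: bij_betw_def simple_graph_def)
        ultimately obtain x y where x: "x \<in> verts G'" "f x = leg_vertex i (Suc j)" "{u, x} \<in> edges G'"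
          and y: "y \<in> verts G'" "f y = leg_vertex i (j - 1)" "{u, y} \<in> edges G'"
          using e new(2) by (metis imageE)
        have "x \<noteq> y"
          using x y by auto
        have "card {{u, x}, {u, y}, {u, w}} \<le> degree G u"
          unfolding degree_def using x y fin by (intro card_mono) (auto simp: G)
        moreover have "card {{u, x}, {u, y}, {u, w}} = 3"
          using \<open>x \<noteq> y\<close> x(1) y(1) new(1) by (auto simp: doubleton_eq_iff card_insert_if)
        moreover have "degree G u \<le> 2"
          using less.prems(3) uw(1) False by blast
        ultimately show False
          by simp
      qed
      let ?as = "as[i := Suc j]"
      have "is_iso (f(w := (i, Suc j))) G (P_tree ?as)"
      proof (rule extend)
        show "(i, Suc j) \<notin> verts (P_tree as)"
          using j by (auto simp: verts_P_tree)
        show "verts (P_tree ?as) = insert (i, Suc j) (verts (P_tree as))"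
          using j ij(2) by (auto simp: verts_P_tree nth_list_update le_Suc_eq split: if_splits)
        have "leg_edges k 0 (?as ! k) = leg_edges k 0 (as ! k) \<union> (if k = i then {{f u, (i, Suc j)}} else {})"
          if "k < length as" for k
          using that j by (auto simp: leg_edges_Suc fu) (auto simp: leg_vertex_def)
        then show "edges (P_tree ?as) = insert {f u, (i, Suc j)} (edges (P_tree as))"
          using ij(2) by (auto simp: edges_P_tree split: if_splits)
      qed
      moreover have "degree G v = degree G' v"
      proof -
        have "{e \<in> edges G. v \<in> e} = {e \<in> edges G'. v \<in> e}"
          using False uw by (auto simp: G)
        then show ?thesis
          by (simp add: degree_def)
      qed
      moreover have "\<forall>a\<in>set ?as. 1 \<le> a"
        using as(1) set_update_subset_insert[of as i "Suc j"] by auto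
      ultimately show ?thesis
        using as f uw by (intro exI[of _ ?as] exI[of _ "f(w := (i, Suc j))"]) auto
    qed
  qed
qed

text \<open>A vertex of maximum degree has degree at least 3, so it is the only such vertex of a
  starlike tree and can serve as the centre.\<close>

lemma starlike_iso_P_tree:
  assumes "starlike T" "max_degree T \<ge> 3"
  shows "\<exists>as. (\<forall>a\<in>set as. 1 \<le> a) \<and> length as = max_degree T \<and> Suc (sum_list as) = order T \<and>
    graph_iso T (P_tree as)"
proof -
  let ?B = "{v \<in> verts T. degree T v \<ge> 3}"
  have tree: "tree T" and card: "card ?B \<le> 1"
    using assms(1) by (auto simp: starlike_def)
  then have V: "finite (verts T)" "verts T \<noteq> {}"
    by (auto simp: tree_def simple_graph_def connected_graph_def)
  then have "max_degree T \<in> degree T ` verts T"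
    unfolding max_degree_def by (intro Max_in) auto
  then obtain v where v: "v \<in> verts T" "max_degree T = degree T v"
    by blast
  have "degree T u \<le> 2" if "u \<in> verts T" "u \<noteq> v" for u
  proof (rule ccontr)
    assume "\<not> degree T u \<le> 2"
    then have "card {u, v} \<le> card ?B"
      using V that v assms(2) by (intro card_mono) auto
    with card that show False
      by simp
  qed
  from tree_iso_P_tree[OF tree v(1) this] obtain as f where as: "\<forall>a\<in>set as. 1 \<le> a"
    "length as = degree T v" "is_iso f T (P_tree as)"
    by blast
  then have "order T = order (P_tree as)"
    by (auto simp: is_iso_def intro: bij_betw_same_card)
  then show ?thesis
    using as v(2) by (auto simp: order_P_tree graph_iso_iff_is_iso)
qed

section \<open>Reordering the legs\<close>

lemma P_tree_iso_mset:
  assumes "mset as = mset bs"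
  shows "graph_iso (P_tree as) (P_tree bs)"
proof -
  obtain g where g: "bij_betw g {..<length as} {..<length bs}"
    and nth: "\<And>i. i < length as \<Longrightarrow> as ! i = bs ! g i"
    using permutation_Ex_bij[OF assms] by blast
  \<comment> \<open>Going through \<open>leg_vertex\<close> fixes the centre \<open>(0, 0)\<close>
    even when \<open>g\<close> moves the index 0.\<close>
  define h where "h = (\<lambda>(i, j). leg_vertex (g i) j)"
  have h: "h (leg_vertex i j) = leg_vertex (g i) j" for i j
    by (simp add: h_def leg_vertex_def)
  have verts: "verts (P_tree cs) = insert (0, 0) (\<Union>i<length cs. leg_vertex i ` {..cs ! i})" for cs
    by (auto simp: P_tree_def)
  have edges: "edges (P_tree cs) = (\<Union>i<length cs. (\<lambda>j. {leg_vertex i j, leg_vertex i (Suc j)}) ` {..<cs ! i})" for cs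
    by (auto simp: P_tree_def)
  have h0: "h (0, 0) = (0, 0)"
    by (simp add: h_def leg_vertex_def)
  have set: "{..<length bs} = g ` {..<length as}"
    using g by (simp add: bij_betw_def)
  have inj: "inj_on h (verts (P_tree as))"
    using g by (auto simp: inj_on_def h_def leg_vertex_def verts_P_tree bij_betw_def)
  have "h ` verts (P_tree as) = insert (0, 0) (\<Union>i<length as. leg_vertex (g i) ` {..as ! i})"
    unfolding verts by (simp add: h0 image_UN image_image h)
  also have "\<dots> = verts (P_tree bs)"
    unfolding verts set using nth by simp
  finally have "bij_betw h (verts (P_tree as)) (verts (P_tree bs))"
    using inj by (simp add: bij_betw_def)
  moreover have E: "edges (P_tree bs) = (`) h ` edges (P_tree as)"
    unfolding edges set using nth by (simp add: image_UN image_image h)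
  have "{u, v} \<in> edges (P_tree as) \<longleftrightarrow> {h u, h v} \<in> edges (P_tree bs)"
    if uv: "u \<in> verts (P_tree as)" "v \<in> verts (P_tree as)" for u v
  proof -
    have "d = {u, v}" if "d \<in> edges (P_tree as)" "h ` d = h ` {u, v}" for d
    proof -
      have "d \<subseteq> verts (P_tree as)" "{u, v} \<subseteq> verts (P_tree as)"
        using uv that(1) simple_P_tree[of as] unfolding simple_graph_def by simp_all
      from inj_on_image_eq_iff[OF inj this] that(2) show ?thesis
        by simp
    qed
    moreover have "{h u, h v} = h ` {u, v}"
      by simp
    ultimately show ?thesis
      unfolding E by (metis (no_types, lifting) imageE imageI)
  qed
  ultimately show ?thesis
    unfolding graph_iso_def by blast
qed

lemma graph_iso_P_tree_mset:
  assumes "graph_iso T (P_tree as)" "mset as = mset bs"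
  shows "graph_iso T (P_tree bs)"
  using assms(1) P_tree_iso_mset[OF assms(2)] is_iso_comp unfolding graph_iso_iff_is_iso by blast

section \<open>Comparing the matching polynomials of starlike trees\<close>

lemma nonneg_prod_list [simp]: "nonneg (prod_list (map path_poly as))"
  by (induction as) simp_all

lemma prod_list_path_poly_neq_0 [simp]: "prod_list (map path_poly as) \<noteq> 0"
  by (induction as) simp_all

lemma nonneg_leg_sum [simp]: "nonneg (leg_sum as)"
  by (induction as) simp_all

lemma leg_sum_neq_0: "as \<noteq> [] \<Longrightarrow> leg_sum as \<noteq> 0"
  by (cases as) (simp_all add: nonneg_add_eq_0_iff)

text \<open>If the centre is matched into a leg of \<open>as\<close>, the first two legs are
  separate paths on \<open>a\<close> and \<open>b\<close> vertices. Otherwise they form with the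
  centre a path on \<open>a + b + 1\<close> vertices, and the legs of \<open>as\<close> are
  separate. Only the first term depends on how \<open>a + b\<close> is split.\<close>

lemma star_poly_Cons_Cons:
  assumes "1 \<le> a" "1 \<le> b"
  shows "star_poly (a # b # as) =
    path_poly a * path_poly b * leg_sum as + path_poly (Suc (a + b)) * prod_list (map path_poly as)"
proof -
  obtain r s where rs: "a = Suc r" "b = Suc s"
    using assms by (metis Suc_le_D One_nat_def)
  have "path_poly (Suc (a + b)) = path_poly (Suc (r + s)) + X * path_poly (r + s) + X * path_poly (Suc (r + s))"
    by (simp add: rs)
  \<comment> \<open>In this path the centre is unmatched, matched into the leg of length
    \<open>a\<close>, or matched into the leg of length \<open>b\<close>.\<close>
  also have "\<dots> = path_poly a * path_poly b + X * path_poly (a - 1) * path_poly b + X * path_poly a * path_poly (b - 1)"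
    using path_poly_exchange[of 0 r s] path_poly_exchange[of 0 "Suc r" s] path_poly_exchange[of 0 r "Suc s"]
    by (simp add: rs algebra_simps)
  finally show ?thesis
    by (simp add: star_poly_def algebra_simps)
qed

text \<open>The terms with a path on \<open>a + b + 1\<close> vertices agree and cancel. What
  remains compares a path on \<open>a + b\<close> vertices with two paths on \<open>a\<close> and
  \<open>b\<close> vertices, which differ by the matchings that use the joining edge.\<close>

lemma star_poly_merge:
  assumes "1 \<le> a" "1 \<le> b"
  shows "star_poly ((a + b) # as) - star_poly (a # b # as) =
    X * path_poly (a - 1) * path_poly (b - 1) * leg_sum as"
proof -
  obtain r s where rs: "a = Suc r" "b = Suc s"
    using assms by (metis Suc_le_D One_nat_def)
  have "star_poly ((a + b) # as) =
      path_poly (a + b) * leg_sum as + path_poly (Suc (a + b)) * prod_list (map path_poly as)"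
    by (simp add: star_poly_def rs algebra_simps)
  then have "star_poly ((a + b) # as) - star_poly (a # b # as) =
      (path_poly (a + b) - path_poly a * path_poly b) * leg_sum as"
    using assms by (simp add: star_poly_Cons_Cons algebra_simps)
  also have "path_poly (a + b) - path_poly a * path_poly b = X * path_poly (a - 1) * path_poly (b - 1)"
    using path_poly_exchange[of 0 r s] by (simp add: rs algebra_simps)
  finally show ?thesis .
qed

lemma star_poly_exchange:
  assumes "1 \<le> a" "1 \<le> b" "1 \<le> c" "1 \<le> d" "a + b = c + d"
  shows "star_poly (a # b # as) - star_poly (c # d # as) =
    (path_poly a * path_poly b - path_poly c * path_poly d) * leg_sum as"
  using assms by (simp add: star_poly_Cons_Cons algebra_simps)

text \<open>
  The sign in \<open>path_poly_exchange\<close> depends only on the parity of \<open>k\<close>, the shortest path involved. So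
  among the pairs of legs with a given sum, those with shorter leg \<open>2, 4, 6, \<dots>, 5, 3, 1\<close> come in
  decreasing order.
\<close>

lemma path_poly_pair_2:
  assumes "1 \<le> a" "3 \<le> d"
  shows "nonneg (path_poly 2 * path_poly (a + d - 2) - path_poly a * path_poly d)"
    and "path_poly 2 * path_poly (a + d - 2) = path_poly a * path_poly d \<Longrightarrow> a = 2"
proof -
  let ?D = "path_poly 2 * path_poly (a + d - 2) - path_poly a * path_poly d"
  have "nonneg ?D \<and> (a \<noteq> 2 \<longrightarrow> ?D \<noteq> 0)"
  proof -
    \<comment> \<open>The exchange identity is used with \<open>k = 1\<close> if
      \<open>a = 1\<close>. If \<open>a \<ge> 3\<close>, the shortest path is the one on 2 vertices:
      \<open>k = 2\<close>, the two products change roles, and the odd power of \<open>- X\<close>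
      makes up for it.\<close>
    consider "a = 1" | "a = 2" | "a \<ge> 3"
      using assms by linarith
    then show ?thesis
    proof cases
      case 1
      obtain s where "d = s + 3"
        using assms le_Suc_ex by (metis add.commute)
      then have "?D = X ^ 2 * path_poly s"
        using path_poly_exchange[of 1 0 s] 1 by (simp add: numeral_eq_Suc algebra_simps)
      then show ?thesis
        by simp
    next
      case 3
      obtain r s where "a = r + 3" "d = s + 3"
        using 3 assms le_Suc_ex by (metis add.commute)
      then have "?D = X ^ 3 * path_poly r * path_poly s"
        using path_poly_exchange[of 2 r s] by (simp add: numeral_eq_Suc algebra_simps)
      then show ?thesis
        by simp
    qed simp
  qed
  then show "nonneg ?D" "path_poly 2 * path_poly (a + d - 2) = path_poly a * path_poly d \<Longrightarrow> a = 2"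
    by auto
qed

text \<open>With legs of length 2 excluded, 4 is the best shorter leg. By symmetry
  \<open>b \<le> c\<close>. The values \<open>b = 1\<close> and \<open>b = 3\<close> with
  \<open>c \<ge> 5\<close> give even powers of \<open>- X\<close>; for \<open>b \<ge> 5\<close> the
  4 is shortest, and the odd power is subtracted.\<close>

lemma path_poly_pair_4:
  assumes "1 \<le> b" "1 \<le> c" "b \<noteq> 2" "c \<noteq> 2" "6 \<le> b + c"
  shows "nonneg (path_poly 4 * path_poly (b + c - 4) - path_poly b * path_poly c)"
    and "path_poly 4 * path_poly (b + c - 4) = path_poly b * path_poly c \<Longrightarrow> b = 4 \<or> c = 4"
proof -
  have *: "nonneg (path_poly 4 * path_poly (b + c - 4) - path_poly b * path_poly c) \<and>
      (b \<noteq> 4 \<and> c \<noteq> 4 \<longrightarrow> path_poly 4 * path_poly (b + c - 4) - path_poly b * path_poly c \<noteq> 0)"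
    if bc: "1 \<le> b" "b \<le> c" "b \<noteq> 2" "c \<noteq> 2" "6 \<le> b + c" for b c
  proof -
    let ?D = "path_poly 4 * path_poly (b + c - 4) - path_poly b * path_poly c"
    consider "b = 4 \<or> c = 4" | "b = 1" "c \<ge> 5" | "b = 3" "c = 3" | "b = 3" "c \<ge> 5" | "b \<ge> 5" "c \<ge> 5"
      using bc by linarith
    then show ?thesis
    proof cases
      case 1
      then show ?thesis by auto
    next
      case 2
      then obtain s where "c = s + 5"
        using le_Suc_ex by (metis add.commute)
      then have "?D = X ^ 2 * path_poly 2 * path_poly s"
        using path_poly_exchange[of 1 2 s] 2 by (simp add: numeral_eq_Suc algebra_simps)
      then show ?thesis
        by simp
    next
      case 3
      \<comment> \<open>The pair \<open>(3, 3)\<close> is compared with \<open>(4, 2)\<close>, so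
        here the shortest path has 2 vertices.\<close>
      then have "?D = X ^ 3"
        using path_poly_exchange[of 2 0 0] by (simp add: numeral_eq_Suc algebra_simps)
      then show ?thesis
        by simp
    next
      case 4
      then obtain s where "c = s + 5"
        using le_Suc_ex by (metis add.commute)
      then have "?D = X ^ 4 * path_poly s"
        using path_poly_exchange[of 3 0 s] 4 by (simp add: numeral_eq_Suc algebra_simps)
      then show ?thesis
        by simp
    next
      case 5
      then obtain r s where "b = r + 5" "c = s + 5"
        using le_Suc_ex by (metis add.commute)
      then have "?D = X ^ 5 * path_poly r * path_poly s"
        using path_poly_exchange[of 4 r s] by (simp add: numeral_eq_Suc algebra_simps)
      then show ?thesis
        by simp
    qed
  qed
  from *[of b c] *[of c b] assms
  show "nonneg (path_poly 4 * path_poly (b + c - 4) - path_poly b * path_poly c)"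
    "path_poly 4 * path_poly (b + c - 4) = path_poly b * path_poly c \<Longrightarrow> b = 4 \<or> c = 4"
    by (cases "b \<le> c"; force simp: add.commute mult.commute)+
qed

text \<open>The chain is \<open>[a, b, c]\<close>, \<open>[a, 4, e]\<close>,
  \<open>[4, 4, a + b + c - 8]\<close>. The bound \<open>7 \<le> b + c\<close> makes
  \<open>e \<ge> 3\<close>, so the intermediate tree has no leg of length 2 either and the
  comparison with 4 applies again.\<close>

lemma star_poly_le_4_4:
  assumes "1 \<le> a" "1 \<le> b" "1 \<le> c" "a \<noteq> 2" "b \<noteq> 2" "c \<noteq> 2" "7 \<le> b + c" "10 \<le> a + b + c"
  defines "D \<equiv> star_poly [4, 4, a + b + c - 8] - star_poly [a, b, c]"
  shows "nonneg D" and "D = 0 \<Longrightarrow> mset [a, b, c] = mset [4, 4, a + b + c - 8]"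
proof -
  define e where "e = b + c - 4"
  let ?D1 = "path_poly 4 * path_poly e - path_poly b * path_poly c"
  let ?D2 = "path_poly 4 * path_poly (a + b + c - 8) - path_poly a * path_poly e"
  have e: "e \<noteq> 2" "1 \<le> e" "6 \<le> a + e" "a + e - 4 = a + b + c - 8"
    using assms by (auto simp: e_def)
  have "star_poly [4, 4, a + b + c - 8] - star_poly [a, 4, e] = ?D2 * leg_sum [4]"
    using star_poly_exchange[of 4 "a + b + c - 8" a e "[4]"] assms e
    by (simp add: star_poly_def algebra_simps e_def)
  moreover have "star_poly [a, 4, e] - star_poly [a, b, c] = ?D1 * leg_sum [a]"
    using star_poly_exchange[of 4 e b c "[a]"] assms e
    by (simp add: star_poly_def algebra_simps e_def)
  ultimately have D: "D = ?D1 * leg_sum [a] + ?D2 * leg_sum [4]"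
    by (simp add: D_def)
  have nonneg: "nonneg (?D1 * leg_sum [a])" "nonneg (?D2 * leg_sum [4])"
    using path_poly_pair_4(1)[of b c] path_poly_pair_4(1)[of a e] assms e
    by (auto simp: e_def simp del: leg_sum.simps)
  then show "nonneg D"
    unfolding D by (rule nonneg_add)
  show "mset [a, b, c] = mset [4, 4, a + b + c - 8]" if "D = 0"
  proof -
    have "?D1 * leg_sum [a] = 0 \<and> ?D2 * leg_sum [4] = 0"
      using that unfolding D nonneg_add_eq_0_iff[OF nonneg] .
    then have "?D1 = 0" "?D2 = 0"
      using leg_sum_neq_0[of "[a]"] leg_sum_neq_0[of "[4]"] by auto
    \<comment> \<open>Since \<open>e = 4\<close> means \<open>b + c = 8\<close>, it forces
      \<open>b = c = 4\<close> here, and then \<open>a\<close> is the third leg.\<close>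
    then have "b = 4 \<or> c = 4" "a = 4 \<or> e = 4"
      using path_poly_pair_4(2)[of b c] path_poly_pair_4(2)[of a e] assms e by (auto simp: e_def)
    then show ?thesis
      by (auto simp: e_def add_mset_commute)
  qed
qed

text \<open>The pairs \<open>(c, d)\<close>, \<open>(b, e)\<close> and \<open>(a, f)\<close> give
  way in turn to pairs with a leg 2. The lower bounds on the sums keep \<open>e\<close> and
  \<open>f\<close> at least 3, as \<open>path_poly_pair_2\<close> demands.\<close>

lemma star_poly_le_2_2_2:
  assumes "1 \<le> a" "1 \<le> b" "1 \<le> c" "3 \<le> d" "5 \<le> c + d" "7 \<le> b + c + d"
  defines "D \<equiv> star_poly [2, 2, 2, a + b + c + d - 6] - star_poly [a, b, c, d]"
  shows "nonneg D" and "D = 0 \<Longrightarrow> a = 2 \<and> b = 2 \<and> c = 2"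
proof -
  define e where "e = c + d - 2"
  define f where "f = b + e - 2"
  define g where "g = a + f - 2"
  let ?D1 = "path_poly 2 * path_poly e - path_poly c * path_poly d"
  let ?D2 = "path_poly 2 * path_poly f - path_poly b * path_poly e"
  let ?D3 = "path_poly 2 * path_poly g - path_poly a * path_poly f"
  have large: "3 \<le> e" "3 \<le> f" "1 \<le> g" "g = a + b + c + d - 6"
    using assms by (auto simp: e_def f_def g_def)
  have sums: "2 + e = c + d" "2 + f = b + e" "2 + g = a + f"
    using assms large by (auto simp: e_def f_def g_def)
  have "star_poly [a, b, 2, e] - star_poly [a, b, c, d] = ?D1 * leg_sum [a, b]"
    using star_poly_exchange[of 2 e c d "[a, b]"] assms sums large
    by (simp add: star_poly_def algebra_simps)
  moreover have "star_poly [a, 2, 2, f] - star_poly [a, b, 2, e] = ?D2 * leg_sum [a, 2]"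
    using star_poly_exchange[of 2 f b e "[a, 2]"] assms sums large
    by (simp add: star_poly_def algebra_simps)
  moreover have "star_poly [2, 2, 2, g] - star_poly [a, 2, 2, f] = ?D3 * leg_sum [2, 2]"
    using star_poly_exchange[of 2 g a f "[2, 2]"] assms sums large
    by (simp add: star_poly_def algebra_simps)
  ultimately have D: "D = ?D1 * leg_sum [a, b] + (?D2 * leg_sum [a, 2] + ?D3 * leg_sum [2, 2])"
    using large by (simp add: D_def)
  have nonneg: "nonneg (?D1 * leg_sum [a, b])" "nonneg (?D2 * leg_sum [a, 2])" "nonneg (?D3 * leg_sum [2, 2])"
    using path_poly_pair_2(1)[of c d] path_poly_pair_2(1)[of b e] path_poly_pair_2(1)[of a f] assms large
    by (auto simp: e_def f_def g_def simp del: leg_sum.simps)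
  then show "nonneg D"
    unfolding D by (intro nonneg_add)
  show "a = 2 \<and> b = 2 \<and> c = 2" if "D = 0"
  proof -
    have "?D1 * leg_sum [a, b] = 0 \<and> ?D2 * leg_sum [a, 2] = 0 \<and> ?D3 * leg_sum [2, 2] = 0"
      using that unfolding D nonneg_add_eq_0_iff[OF nonneg(1) nonneg_add[OF nonneg(2,3)]]
        nonneg_add_eq_0_iff[OF nonneg(2,3)] .
    then have "?D1 = 0" "?D2 = 0" "?D3 = 0"
      using leg_sum_neq_0 by (metis list.distinct(1) mult_eq_0_iff)+
    then show ?thesis
      using path_poly_pair_2(2)[of c d] path_poly_pair_2(2)[of b e] path_poly_pair_2(2)[of a f] assms large
      by (simp add: e_def f_def g_def)
  qed
qed

text \<open>The symmetry, hidden by the recursive \<open>leg_sum\<close>, comes from the isomorphism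
  of the trees.\<close>

lemma star_poly_mset:
  assumes "mset as = mset bs" "\<forall>a\<in>set as. 1 \<le> a"
  shows "star_poly as = star_poly bs"
proof -
  have "\<forall>b\<in>set bs. 1 \<le> b"
    using assms by (metis set_mset_mset)
  then show ?thesis
    using matching_poly_iso[OF P_tree_iso_mset[OF assms(1)] simple_P_tree simple_P_tree] assms(2)
    by (simp add: matching_poly_P_tree)
qed

text \<open>The legs are sorted so that \<open>b\<close> and \<open>c\<close> are the two longest; a
  total of at least 10 then yields \<open>7 \<le> b + c\<close>.\<close>

lemma star_poly_three_legs:
  assumes "length as = 3" "\<forall>a\<in>set as. 1 \<le> a" "2 \<notin> set as" "10 \<le> sum_list as"
  defines "bs \<equiv> [4, 4, sum_list as - 8]"
  shows "nonneg (star_poly bs - star_poly as) \<and> (star_poly bs - star_poly as = 0 \<longrightarrow> mset as = mset bs)"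
proof -
  define ss where "ss = sort as"
  have "length ss = 3"
    using assms(1) by (simp add: ss_def)
  then obtain a b c where "ss = [a, b, c]"
    by (auto simp: length_Suc_conv numeral_3_eq_3)
  then have abc: "sort as = [a, b, c]"
    by (simp add: ss_def)
  then have mset: "mset as = mset [a, b, c]"
    by (metis mset_sort)
  then have set: "set as = {a, b, c}" and sum: "sum_list as = a + b + c"
    by (auto simp flip: set_mset_mset sum_mset_sum_list)
  have "sorted [a, b, c]"
    using sorted_sort[of as] by (simp add: abc)
  then have "a \<le> b" "b \<le> c"
    by simp_all
  moreover have "star_poly as = star_poly [a, b, c]"
    using star_poly_mset[OF mset assms(2)] .
  ultimately show ?thesis
    using star_poly_le_4_4[of a b c] assms(2-4) unfolding bs_def mset sum set by simp
qed

text \<open>After sorting, a total of at least 10 forces \<open>3 \<le> d\<close>,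
  \<open>5 \<le> c + d\<close> and \<open>7 \<le> b + c + d\<close>.\<close>

lemma star_poly_four_legs:
  assumes "length as = 4" "\<forall>a\<in>set as. 1 \<le> a" "10 \<le> sum_list as"
  defines "bs \<equiv> [2, 2, 2, sum_list as - 6]"
  shows "nonneg (star_poly bs - star_poly as) \<and> (star_poly bs - star_poly as = 0 \<longrightarrow> mset as = mset bs)"
proof -
  define ss where "ss = sort as"
  have "length ss = 4"
    using assms(1) by (simp add: ss_def)
  then obtain a b c d where "ss = [a, b, c, d]"
    by (auto simp: length_Suc_conv numeral_eq_Suc)
  then have abcd: "sort as = [a, b, c, d]"
    by (simp add: ss_def)
  then have mset: "mset as = mset [a, b, c, d]"
    by (metis mset_sort)
  then have set: "set as = {a, b, c, d}" and sum: "sum_list as = a + b + c + d"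
    by (auto simp flip: set_mset_mset sum_mset_sum_list)
  have "sorted [a, b, c, d]"
    using sorted_sort[of as] by (simp add: abcd)
  then have "a \<le> b" "b \<le> c" "c \<le> d"
    by simp_all
  moreover have "star_poly as = star_poly [a, b, c, d]"
    using star_poly_mset[OF mset assms(2)] .
  ultimately show ?thesis
    using star_poly_le_2_2_2[of a b c d] assms(2,3) unfolding bs_def mset sum set by auto
qed

text \<open>Two legs are merged until four are left. Each merge is a strict increase, so equality is
  possible only if nothing was merged.\<close>

lemma star_poly_le_four_legs:
  assumes "4 \<le> length as" "\<forall>a\<in>set as. 1 \<le> a"
  shows "\<exists>bs. length bs = 4 \<and> (\<forall>b\<in>set bs. 1 \<le> b) \<and> sum_list bs = sum_list as \<and>
    nonneg (star_poly bs - star_poly as) \<and> (star_poly bs - star_poly as = 0 \<longrightarrow> bs = as)"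
  using assms
proof (induction "length as" arbitrary: as rule: less_induct)
  case less
  show ?case
  proof (cases "length as = 4")
    case True
    with less.prems show ?thesis
      by (intro exI[of _ as]) simp
  next
    case False
    then have "5 \<le> length as"
      using less.prems(1) by simp
    then obtain a b cs where as: "as = a # b # cs" "3 \<le> length cs"
      by (auto simp: Suc_le_length_iff numeral_eq_Suc)
    have "\<exists>bs. length bs = 4 \<and> (\<forall>b\<in>set bs. 1 \<le> b) \<and> sum_list bs = sum_list ((a + b) # cs) \<and>
        nonneg (star_poly bs - star_poly ((a + b) # cs)) \<and>
        (star_poly bs - star_poly ((a + b) # cs) = 0 \<longrightarrow> bs = (a + b) # cs)"
      using less.prems by (intro less.hyps) (auto simp: as)
    then obtain bs where bs: "length bs = 4" "\<forall>b\<in>set bs. 1 \<le> b" "sum_list bs = sum_list ((a + b) # cs)"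
      "nonneg (star_poly bs - star_poly ((a + b) # cs))"
      by blast
    have merge: "star_poly ((a + b) # cs) - star_poly as = X * path_poly (a - 1) * path_poly (b - 1) * leg_sum cs"
      using star_poly_merge less.prems(2) by (simp add: as)
    then have merge_nonneg: "nonneg (star_poly ((a + b) # cs) - star_poly as)"
      by simp
    \<comment> \<open>A remaining leg makes \<open>leg_sum cs\<close> nonzero, hence the merge
      strict.\<close>
    have "cs \<noteq> []"
      using as(2) by auto
    then have "star_poly ((a + b) # cs) - star_poly as \<noteq> 0"
      using leg_sum_neq_0[of cs] unfolding merge by simp
    then have "nonneg (star_poly bs - star_poly as) \<and> star_poly bs - star_poly as \<noteq> 0"
      using nonneg_add[OF bs(4) merge_nonneg] nonneg_add_eq_0_iff[OF bs(4) merge_nonneg] by simp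
    moreover have "sum_list bs = sum_list as"
      using bs(3) by (simp add: as)
    ultimately show ?thesis
      using bs(1,2) by blast
  qed
qed

section \<open>From polynomials back to trees\<close>

lemma matching_less_P_tree:
  assumes "simple_graph T" "graph_iso T (P_tree as)" "\<forall>a\<in>set as. 1 \<le> a" "\<forall>b\<in>set bs. 1 \<le> b"
    and "nonneg (star_poly bs - star_poly as)" "star_poly bs - star_poly as \<noteq> 0"
  shows "T \<prec> P_tree bs"
  using assms matching_poly_iso[OF assms(2,1) simple_P_tree]
  by (simp add: matching_less_iff finite_edges simple_P_tree matching_poly_P_tree)

theorem theorem5p2:
  fixes n :: nat
  assumes "n \<ge> 11"
  shows "(\<forall>T :: 'a graph.
            starlike T \<and> order T = n \<and> max_degree T = 3 \<and>
            \<not> (\<exists>H \<in> S_trees n. graph_iso T H) \<and> \<not> graph_iso T (P_tree [4, 4, n - 9])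
            \<longrightarrow> T \<prec> P_tree [4, 4, n - 9]) \<and>
         (\<forall>T :: 'a graph.
            starlike T \<and> order T = n \<and> max_degree T \<ge> 4 \<and>
            \<not> graph_iso T (P_tree [2, 2, 2, n - 7])
            \<longrightarrow> T \<prec> P_tree [2, 2, 2, n - 7])"
proof (intro conjI allI impI; elim conjE)
  fix T :: "'a graph"
  assume T: "starlike T" "order T = n" "max_degree T = 3"
    and not_S: "\<not> (\<exists>H \<in> S_trees n. graph_iso T H)" and not_iso: "\<not> graph_iso T (P_tree [4, 4, n - 9])"
  obtain as where as: "\<forall>a\<in>set as. 1 \<le> a" "length as = 3" "Suc (sum_list as) = n"
    and iso: "graph_iso T (P_tree as)"
    using starlike_iso_P_tree[of T] T by auto
  have "2 \<notin> set as"
  proof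
    assume "2 \<in> set as"
    \<comment> \<open>The other two legs in increasing order are the \<open>a \<le> b\<close> that
      place \<open>T\<close> in \<open>S_trees n\<close>.\<close>
    define ss where "ss = sort (remove1 2 as)"
    have "length ss = 2"
      using as(2) \<open>2 \<in> set as\<close> by (simp add: ss_def length_remove1)
    then obtain a b where "ss = [a, b]"
      by (auto simp: length_Suc_conv numeral_2_eq_2)
    then have ab: "sort (remove1 2 as) = [a, b]"
      by (simp add: ss_def)
    then have "mset (remove1 2 as) = mset [a, b]"
      by (metis mset_sort)
    then have mset: "mset as = mset [2, a, b]"
      using \<open>2 \<in> set as\<close> by (metis mset.simps(2) perm_remove)
    then have "set as = {2, a, b}" "sum_list as = 2 + a + b"
      by (auto simp flip: set_mset_mset sum_mset_sum_list)
    moreover have "sorted [a, b]"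
      using sorted_sort[of "remove1 2 as"] by (simp add: ab)
    ultimately have "a + b = n - 3 \<and> 1 \<le> a \<and> a \<le> b"
      using as(1,3) by auto
    then have "P_tree [2, a, b] \<in> S_trees n"
      unfolding S_trees_def by blast
    then show False
      using not_S graph_iso_P_tree_mset[OF iso mset] by blast
  qed
  have "mset as \<noteq> mset [4, 4, n - 9]"
    using not_iso graph_iso_P_tree_mset[OF iso] by blast
  \<comment> \<open>The centre counts towards the order, so the legs sum to \<open>n - 1\<close>,
    which is at least 10.\<close>
  moreover have "n - 9 = sum_list as - 8"
    using as(3) by simp
  ultimately show "T \<prec> P_tree [4, 4, n - 9]"
    using star_poly_three_legs[of as] as \<open>2 \<notin> set as\<close> T(1) assms iso
    by (intro matching_less_P_tree[of T as]) (auto simp: starlike_def tree_def)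
next
  fix T :: "'a graph"
  assume T: "starlike T" "order T = n" "4 \<le> max_degree T"
    and not_iso: "\<not> graph_iso T (P_tree [2, 2, 2, n - 7])"
  obtain as where as: "\<forall>a\<in>set as. 1 \<le> a" "4 \<le> length as" "Suc (sum_list as) = n"
    and iso: "graph_iso T (P_tree as)"
    using starlike_iso_P_tree[of T] T by auto
  obtain bs where bs: "length bs = 4" "\<forall>b\<in>set bs. 1 \<le> b" "sum_list bs = sum_list as"
    and le: "nonneg (star_poly bs - star_poly as)" "star_poly bs - star_poly as = 0 \<longrightarrow> bs = as"
    using star_poly_le_four_legs[OF as(2,1)] by blast
  let ?cs = "[2, 2, 2, n - 7]"
  have "n - 7 = sum_list bs - 6"
    using as(3) bs(3) by simp
  then have le': "nonneg (star_poly ?cs - star_poly bs)"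
    "star_poly ?cs - star_poly bs = 0 \<longrightarrow> mset bs = mset ?cs"
    using star_poly_four_legs[OF bs(1,2)] as(3) bs(3) assms by auto
  have "mset as \<noteq> mset ?cs"
    using not_iso graph_iso_P_tree_mset[OF iso] by blast
  \<comment> \<open>If the total difference vanished, both steps would: \<open>bs = as\<close> from
    the merging and \<open>mset bs = mset ?cs\<close> from the exchanges, contradicting that
    \<open>as\<close> is not a reordering of \<open>?cs\<close>.\<close>
  then have "nonneg (star_poly ?cs - star_poly as) \<and> star_poly ?cs - star_poly as \<noteq> 0"
    using nonneg_add[OF le'(1) le(1)] nonneg_add_eq_0_iff[OF le'(1) le(1)] le(2) le'(2) by auto
  then show "T \<prec> P_tree ?cs"
    using as(1) T(1) assms iso
    by (intro matching_less_P_tree[of T as]) (auto simp: starlike_def tree_def)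
qed

end
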